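(* Let $\Omega\subset\mathbb{R}^n$ be an open and bounded domain with Lipschitz boundary and diameter $d$, let $s\in(0,1)$, and let $G$ be a Young function with $g=G'$ satisfying $$\int_1^\infty\left(\frac{t}{G(t)}\right)^{\frac{s}{n-s}}dt=\infty,\qquad \int_0^1\left(\frac{t}{G(t)}\right)^{\frac{s}{n-s}}dt<\infty.$$ Fix $\alpha_0>0$. For each $\alpha>0$ let $u_\alpha\in W^s_0L^G(\Omega)$ be a solution of $\min\{\mathcal{F}(u):u\in W^s_0L^G(\Omega),\ \mathcal{J}(u)=\alpha\}$ and let $\lambda_\alpha>0$ be such that $u_\alpha$ is a weak solution of the eigenvalue problem with parameter $\lambda_\alpha$; let $\hat\lambda=\inf\{\lambda_\alpha:0<\alpha\le\alpha_0\}$. If for a fixed $\varepsilon>0$ $$d\le\left(\frac{1}{2(1+\varepsilon)}\min\left\{1,\frac{n\omega_n}{2s}\right\}\right)^{\frac1s},$$ where $\omega_n$ is the volume of the unit ball in $\mathbb{R}^n$, then $\lambda_\alpha\ge\varepsilon$ for every $\alpha>0$, and $\hat\lambda\ge\varepsilon$.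
   Context: A Young function is a map $G:[0,\infty)\to[0,\infty)$ of the form $G(t)=\int_0^t g(\tau)\,d\tau$, where $g:[0,\infty)\to[0,\infty)$ is right continuous, nondecreasing on $(0,\infty)$, $g(0)=0$, $g(t)>0$ for $t>0$, and $\lim_{t\to\infty}g(t)=\infty$; "$g=G'$" refers to this $g$. No $\Delta_2$ (doubling) condition is assumed. Its complementary function is $\tilde G(t)=\sup\{tw-G(w):w>0\}$. The expression $g(|t|)\frac{t}{|t|}$ is $0$ at $t=0$. For a measure space $(X,\nu)$, $K^G(X,\nu)$ is the set of measurable $u$ with $\int_X G(|u|)\,d\nu<\infty$; $L^G(X,\nu)$ is its linear hull, normed by $\|u\|_G=\inf\{\lambda>0:\int_X G(|u|/\lambda)\,d\nu\le1\}$; $E^G(X,\nu)$ is the closure in $L^G(X,\nu)$ of the bounded measurable functions (supported on sets of finite measure if $\nu(X)=\infty$). On $\Omega$ one uses Lebesgue measure. One has $(E^{\tilde G})'=L^G$. Set $D_su(x,y)=\frac{u(x)-u(y)}{|x-y|^s}$ and $d\mu=\frac{dx\,dy}{|x-y|^n}$ on $\mathbb{R}^n\times\mathbb{R}^n$. $W^sL^G(\Omega)$ is the space of measurable functions $u$ on $\mathbb{R}^n$ with $u|_\Omega\in L^G(\Omega)$ and $D_su\in L^G(\mathbb{R}^n\times\mathbb{R}^n,d\mu)$, with norm $\|u\|_{s,G}=\|u\|_G+[u]_{s,G}$, where $[u]_{s,G}=\inf\{\lambda>0:\iint G(|D_su|/\lambda)\,d\mu\le1\}$. Via $u\mapsto(u,D_su)$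 it is regarded as a subspace of $L^G(\Omega)\times L^G(\mathbb{R}^n\times\mathbb{R}^n,d\mu)$, the dual of $E^{\tilde G}(\Omega)\times E^{\tilde G}(\mathbb{R}^n\times\mathbb{R}^n,d\mu)$; weak* refers to this duality. $W^s_0L^G(\Omega)$ is the weak* closure of $C_c^\infty(\Omega)$ (functions extended by zero outside $\Omega$) in $W^sL^G(\Omega)$. $\mathcal{F}(u)=\iint_{\mathbb{R}^n\times\mathbb{R}^n}G(|D_su|)\,d\mu$ and $\mathcal{J}(u)=\int_\Omega G(|u|)\,dx$. The eigenvalue problem with parameter $\lambda$ is $(-\Delta_g)^su=\lambda g(|u|)\frac{u}{|u|}$ in $\Omega$, $u=0$ in $\mathbb{R}^n\setminus\Omega$; a weak solution is $u\in W^s_0L^G(\Omega)$ such that $$\iint_{\mathbb{R}^n\times\mathbb{R}^n} g(|D_su|)\frac{D_su}{|D_su|}D_sv\,d\mu=\lambda\int_\Omega g(|u|)\frac{u}{|u|}v\,dx\quad\text{for all }v\in W^s_0L^G(\Omega).$$ (The paper shows that such $u_\alpha$ and $\lambda_\alpha$ exist for every $\alpha>0$.) *)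

theory Defs
  imports "HOL-Analysis.Analysis"
begin

text \<open>
  Functions on $[0,\infty)$ are total functions on \<^typ>\<open>real\<close> whose values at negative
  arguments are never used.  Elements of function spaces are functions, not classes modulo
  equality almost everywhere.
\<close>

section \<open>Young functions\<close>

definition young_function :: "(real \<Rightarrow> real) \<Rightarrow> (real \<Rightarrow> real) \<Rightarrow> bool" where
  "young_function G g \<longleftrightarrow>
     (\<forall>t\<ge>0. g t \<ge> 0) \<and>
     (\<forall>t\<ge>0. continuous (at_right t) g) \<and>
     mono_on {0<..} g \<and>
     g 0 = 0 \<and>
     (\<forall>t>0. g t > 0) \<and>
     filterlim g at_top at_top \<and>
     (\<forall>t\<ge>0. (g has_integral G t) {0..t})"

definition complementary :: "(real \<Rightarrow> real) \<Rightarrow> real \<Rightarrow> real" where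
  "complementary G t = (SUP w\<in>{0<..}. t * w - G w)"

section \<open>Orlicz spaces\<close>

definition orlicz_modular :: "'b measure \<Rightarrow> (real \<Rightarrow> real) \<Rightarrow> ('b \<Rightarrow> real) \<Rightarrow> ennreal" where
  "orlicz_modular M G u = (\<integral>\<^sup>+x. ennreal (G \<bar>u x\<bar>) \<partial>M)"

definition orlicz_class :: "'b measure \<Rightarrow> (real \<Rightarrow> real) \<Rightarrow> ('b \<Rightarrow> real) set" where
  "orlicz_class M G = {u \<in> borel_measurable M. orlicz_modular M G u < \<infinity>}"

definition linear_hull :: "('b \<Rightarrow> real) set \<Rightarrow> ('b \<Rightarrow> real) set" where
  "linear_hull K =
     {u. \<exists>(m::nat) c f. (\<forall>i<m. f i \<in> K) \<and> u = (\<lambda>x. \<Sum>i<m. c i * f i x)}"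

definition orlicz_space :: "'b measure \<Rightarrow> (real \<Rightarrow> real) \<Rightarrow> ('b \<Rightarrow> real) set" where
  "orlicz_space M G = linear_hull (orlicz_class M G)"

definition orlicz_norm :: "'b measure \<Rightarrow> (real \<Rightarrow> real) \<Rightarrow> ('b \<Rightarrow> real) \<Rightarrow> real" where
  "orlicz_norm M G u = Inf {l. l > 0 \<and> orlicz_modular M G (\<lambda>x. u x / l) \<le> 1}"

definition bounded_functions :: "'b measure \<Rightarrow> ('b \<Rightarrow> real) set" where
  "bounded_functions M =
     {v \<in> borel_measurable M.
        (\<exists>C. \<forall>x\<in>space M. \<bar>v x\<bar> \<le> C) \<and>
        (emeasure M (space M) = \<infinity> \<longrightarrow> emeasure M {x \<in> space M. v x \<noteq> 0} < \<infinity>)}"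

definition orlicz_E :: "'b measure \<Rightarrow> (real \<Rightarrow> real) \<Rightarrow> ('b \<Rightarrow> real) set" where
  "orlicz_E M G =
     {u \<in> orlicz_space M G.
        \<forall>\<delta>>0. \<exists>v \<in> bounded_functions M. orlicz_norm M G (\<lambda>x. u x - v x) < \<delta>}"

text \<open>
  The weak* topology on $L^G(M) \times L^G(N)$, the dual of
  $E^{\tilde G}(M) \times E^{\tilde G}(N)$: the coarsest topology for which every pairing
  $(u,U) \mapsto \int u \varphi \, dM + \int U \Phi \, dN$ is continuous.
\<close>

definition weak_star_topology ::
  "'b measure \<Rightarrow> 'c measure \<Rightarrow> (real \<Rightarrow> real) \<Rightarrow> (('b \<Rightarrow> real) \<times> ('c \<Rightarrow> real)) topology" where
  "weak_star_topology M N G =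
     (let P = orlicz_E M (complementary G) \<times> orlicz_E N (complementary G) in
      pullback_topology (orlicz_space M G \<times> orlicz_space N G)
        (\<lambda>(u, U). \<lambda>(\<phi>, \<Phi>)\<in>P. (\<integral>x. u x * \<phi> x \<partial>M) + (\<integral>z. U z * \<Phi> z \<partial>N))
        (product_topology (\<lambda>_. euclideanreal) P))"

section \<open>Fractional Orlicz--Sobolev spaces\<close>

definition D_frac :: "real \<Rightarrow> ('a::euclidean_space \<Rightarrow> real) \<Rightarrow> 'a \<times> 'a \<Rightarrow> real" where
  "D_frac s u = (\<lambda>(x, y). (u x - u y) / norm (x - y) powr s)"

text \<open>On the diagonal, a null set, both the density below and \<^const>\<open>D_frac\<close> take the value $0$.\<close>

definition mu_frac :: "('a::euclidean_space \<times> 'a) measure" where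
  "mu_frac = density lebesgue (\<lambda>(x, y). ennreal (1 / norm (x - y) ^ DIM('a)))"

definition WsLG :: "real \<Rightarrow> (real \<Rightarrow> real) \<Rightarrow> 'a::euclidean_space set \<Rightarrow> ('a \<Rightarrow> real) set" where
  "WsLG s G \<Omega> =
     {u \<in> borel_measurable lebesgue.
        u \<in> orlicz_space (lebesgue_on \<Omega>) G \<and> D_frac s u \<in> orlicz_space mu_frac G}"

definition WsLG_weak_star ::
  "real \<Rightarrow> (real \<Rightarrow> real) \<Rightarrow> 'a::euclidean_space set \<Rightarrow> ('a \<Rightarrow> real) topology" where
  "WsLG_weak_star s G \<Omega> =
     pullback_topology (WsLG s G \<Omega>) (\<lambda>u. (u, D_frac s u))
       (weak_star_topology (lebesgue_on \<Omega>) mu_frac G)"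

primrec Ck :: "nat \<Rightarrow> ('a::euclidean_space \<Rightarrow> real) \<Rightarrow> bool" where
  "Ck 0 f \<longleftrightarrow> continuous_on UNIV f"
| "Ck (Suc k) f \<longleftrightarrow>
     (\<forall>x. f differentiable (at x)) \<and>
     (\<forall>b\<in>Basis. Ck k (\<lambda>x. frechet_derivative f (at x) b))"

definition Cc_infinity :: "'a::euclidean_space set \<Rightarrow> ('a \<Rightarrow> real) set" where
  "Cc_infinity \<Omega> =
     {f. (\<forall>k. Ck k f) \<and> compact (closure {x. f x \<noteq> 0}) \<and> closure {x. f x \<noteq> 0} \<subseteq> \<Omega>}"

definition WsLG0 :: "real \<Rightarrow> (real \<Rightarrow> real) \<Rightarrow> 'a::euclidean_space set \<Rightarrow> ('a \<Rightarrow> real) set" where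
  "WsLG0 s G \<Omega> = (WsLG_weak_star s G \<Omega>) closure_of (Cc_infinity \<Omega>)"

section \<open>The eigenvalue problem\<close>

definition energy_F :: "real \<Rightarrow> (real \<Rightarrow> real) \<Rightarrow> ('a::euclidean_space \<Rightarrow> real) \<Rightarrow> ennreal" where
  "energy_F s G u = orlicz_modular mu_frac G (D_frac s u)"

definition energy_J ::
  "(real \<Rightarrow> real) \<Rightarrow> 'a::euclidean_space set \<Rightarrow> ('a \<Rightarrow> real) \<Rightarrow> ennreal" where
  "energy_J G \<Omega> u = orlicz_modular (lebesgue_on \<Omega>) G u"

definition minimizer ::
  "real \<Rightarrow> (real \<Rightarrow> real) \<Rightarrow> 'a::euclidean_space set \<Rightarrow> real \<Rightarrow> ('a \<Rightarrow> real) \<Rightarrow> bool" where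
  "minimizer s G \<Omega> \<alpha> u \<longleftrightarrow>
     is_arg_min (energy_F s G) (\<lambda>v. v \<in> WsLG0 s G \<Omega> \<and> energy_J G \<Omega> v = ennreal \<alpha>) u"

text \<open>
  The two \<^const>\<open>integrable\<close> conjuncts say that both sides of the weak formulation are finite
  integrals; without them the equation could hold through the default value $0$ of the
  integral.  For $t = 0$ the factor $t/|t|$ is $0$.
\<close>

definition weak_solution ::
  "real \<Rightarrow> (real \<Rightarrow> real) \<Rightarrow> (real \<Rightarrow> real) \<Rightarrow> 'a::euclidean_space set \<Rightarrow> real \<Rightarrow> ('a \<Rightarrow> real) \<Rightarrow> bool"
where
  "weak_solution s G g \<Omega> l u \<longleftrightarrow>
     u \<in> WsLG0 s G \<Omega> \<and>
     (\<forall>v \<in> WsLG0 s G \<Omega>.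
        (let a = (\<lambda>z. g \<bar>D_frac s u z\<bar> * (D_frac s u z / \<bar>D_frac s u z\<bar>) * D_frac s v z);
             b = (\<lambda>x. g \<bar>u x\<bar> * (u x / \<bar>u x\<bar>) * v x)
         in integrable mu_frac a \<and> integrable (lebesgue_on \<Omega>) b \<and>
            integral\<^sup>L mu_frac a = l * integral\<^sup>L (lebesgue_on \<Omega>) b))"

section \<open>Lipschitz boundary\<close>

text \<open>
  Near each boundary point the set is the region strictly above the graph of a Lipschitz
  function over the hyperplane orthogonal to some unit vector \<open>e\<close>.
\<close>

definition lipschitz_boundary :: "'a::euclidean_space set \<Rightarrow> bool" where
  "lipschitz_boundary \<Omega> \<longleftrightarrow>
     (\<forall>p \<in> frontier \<Omega>. \<exists>r>0. \<exists>e L \<gamma>. norm e = 1 \<and>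
        lipschitz_on L {y. y \<bullet> e = 0} \<gamma> \<and>
        \<Omega> \<inter> ball p r = {x \<in> ball p r. x \<bullet> e > \<gamma> (x - (x \<bullet> e) *\<^sub>R e)})"

end

theory Submission
  imports Defs
begin

text \<open>
  Test the equation with the eigenfunction \<open>u\<close> itself.  Since \<open>u = 0\<close> almost everywhere outside
  \<open>\<Omega>\<close>, the double integral is at least its part over \<open>x \<in> \<Omega>\<close>, \<open>d < |x - y| \<le> 1\<close>, where \<open>u y = 0\<close>
  and \<open>|D u| = |u x| / |x - y| powr s \<ge> |u x|\<close>.  As \<open>g\<close> is nondecreasing, this part is at least
  \<open>c \<integral> g |u| |u|\<close>, where \<open>c\<close> is a lower bound for the integral of \<open>|z| powr (- n - s)\<close> over the
  shell \<open>d < |z| \<le> 1\<close>, so \<open>\<lambda> \<ge> c\<close>; the condition on \<open>d\<close> makes \<open>c\<close> at least \<open>\<epsilon>\<close>.  That \<open>u\<close> vanishes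
  outside \<open>\<Omega>\<close> is not part of the definition of the weak* closure; it comes from functionals in
  the predual that vanish on all test functions.
\<close>

section \<open>Young functions and their complementary functions\<close>

lemma young_function_bounds:
  assumes "young_function G g"
  shows young_nonneg: "t \<ge> 0 \<Longrightarrow> G t \<ge> 0"
    and young_zero: "G 0 = 0"
    and young_deriv_mono: "0 \<le> t \<Longrightarrow> t \<le> t' \<Longrightarrow> g t \<le> g t'"
proof -
  have int: "(g has_integral G t) {0..t}" if "t \<ge> 0" for t
    using assms that by (simp add: young_function_def)
  have nonneg: "g t \<ge> 0" if "t \<ge> 0" for t
    using assms that by (simp add: young_function_def)
  show "t \<ge> 0 \<Longrightarrow> G t \<ge> 0"
    using has_integral_nonneg[OF int] nonneg by auto
  show "G 0 = 0"
    using integral_unique[OF int[of 0]] by simp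
  \<comment> \<open>Monotonicity is assumed only on the open half line; at \<open>t = 0\<close> it
    follows from \<open>g 0 = 0\<close> and \<open>g t' \<ge> 0\<close>.\<close>
  show "0 \<le> t \<Longrightarrow> t \<le> t' \<Longrightarrow> g t \<le> g t'"
    using assms nonneg[of t'] unfolding young_function_def mono_on_def
    by (cases "t = 0") auto
qed

text \<open>Since \<open>g\<close> tends to infinity, \<open>g \<ge> c\<close> beyond some
  \<open>T\<close>, so \<open>G w \<ge> c * (w - T)\<close> there; up to \<open>T\<close> the bound
  \<open>c * w \<le> c * T\<close> is enough. This makes the supremum in
  \<open>complementary\<close> finite.\<close>

lemma young_superlinear:
  assumes Y: "young_function G g" and c: "c \<ge> 0"
  obtains C where "\<And>w. w \<ge> 0 \<Longrightarrow> c * w - G w \<le> C"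
proof -
  have "eventually (\<lambda>t. g t \<ge> c) at_top"
    using Y by (auto simp: young_function_def filterlim_at_top)
  then obtain T0 where T0: "\<And>t. t \<ge> T0 \<Longrightarrow> g t \<ge> c"
    by (auto simp: eventually_at_top_linorder)
  define T where "T = max T0 0"
  have T: "T \<ge> 0" "\<And>t. t \<ge> T \<Longrightarrow> g t \<ge> c"
    using T0 by (auto simp: T_def)
  have "c * w - G w \<le> c * T" if w: "w \<ge> 0" for w
  proof (cases "w \<le> T")
    case True
    then show ?thesis
      using young_nonneg[OF Y w] c by (smt (verit) mult_left_mono)
  next
    case False
    have int: "(g has_integral G w) {0..w}"
      using Y w by (simp add: young_function_def)
    then have gi: "g integrable_on {0..w}" by blast
    then have gT: "g integrable_on {T..w}"
      using T by (intro integrable_on_subinterval[OF gi]) auto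
    have "c * (w - T) \<le> integral {T..w} g"
    proof -
      have "((\<lambda>_. c) has_integral (w - T) * c) {T..w}"
        using has_integral_const_real[of c T w] False by simp
      from has_integral_le[OF this integrable_integral[OF gT]] show ?thesis
        using T by (auto simp: mult.commute)
    qed
    also have "\<dots> \<le> integral {0..w} g"
      using T gi gT Y by (intro integral_subset_le) (auto simp: young_function_def)
    also have "\<dots> = G w"
      using int by (rule integral_unique)
    finally show ?thesis
      by (simp add: algebra_simps)
  qed
  then show thesis by (rule that)
qed

text \<open>The bound for the largest slope \<open>c\<close> serves every smaller \<open>t\<close>,
  because only \<open>w > 0\<close> enters the supremum. For \<open>c < 0\<close> no
  \<open>t\<close> qualifies.\<close>

lemma complementary_bounded:
  assumes Y: "young_function G g"
  obtains C where "\<And>t. 0 \<le> t \<Longrightarrow> t \<le> c \<Longrightarrow> complementary G t \<le> C"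
proof (cases "c \<ge> 0")
  case True
  then obtain C where C: "\<And>w. w \<ge> 0 \<Longrightarrow> c * w - G w \<le> C"
    using young_superlinear[OF Y] by blast
  have "complementary G t \<le> C" if "0 \<le> t" "t \<le> c" for t
    unfolding complementary_def
  proof (rule cSUP_least)
    fix w :: real assume w: "w \<in> {0<..}"
    then have "t * w \<le> c * w" using that by (intro mult_right_mono) auto
    moreover have "c * w - G w \<le> C" using C[of w] w by simp
    ultimately show "t * w - G w \<le> C" by linarith
  qed auto
  then show thesis by (rule that)
next
  case False
  then show thesis by (intro that[of 0]) auto
qed

text \<open>An upper bound suffices: \<open>ennreal\<close> sends nonpositive values to 0, so points
  where a function vanishes contribute nothing to its modular for
  \<open>complementary G\<close>.\<close>

lemma complementary_zero_le:
  assumes Y: "young_function G g"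
  shows "complementary G 0 \<le> 0"
  unfolding complementary_def
  by (rule cSUP_least) (use young_nonneg[OF Y] in auto)

section \<open>Predual elements and the weak* closure\<close>

text \<open>The modular is at most a constant times the measure of the support, which gives
  membership in the Orlicz class; being bounded, the function is its own approximant.\<close>

lemma bounded_in_orlicz_E:
  assumes Y: "young_function G g"
    and [measurable]: "\<phi> \<in> borel_measurable M"
    and bdd: "\<And>x. x \<in> space M \<Longrightarrow> \<bar>\<phi> x\<bar> \<le> c"
    and fin: "emeasure M {x \<in> space M. \<phi> x \<noteq> 0} < \<infinity>"
  shows "\<phi> \<in> orlicz_E M (complementary G)"
proof -
  let ?H = "complementary G"
  obtain C where C: "\<And>t. 0 \<le> t \<Longrightarrow> t \<le> c \<Longrightarrow> ?H t \<le> C"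
    using complementary_bounded[OF Y] by blast
  have H0: "?H 0 \<le> 0" by (rule complementary_zero_le[OF Y])
  have "orlicz_modular M ?H \<phi> \<le> (\<integral>\<^sup>+x. ennreal C * indicator {x \<in> space M. \<phi> x \<noteq> 0} x \<partial>M)"
    unfolding orlicz_modular_def
  proof (rule nn_integral_mono)
    fix x assume "x \<in> space M"
    then show "ennreal (?H \<bar>\<phi> x\<bar>) \<le> ennreal C * indicator {x \<in> space M. \<phi> x \<noteq> 0} x"
      using C[of "\<bar>\<phi> x\<bar>"] bdd[of x] H0
      by (cases "\<phi> x = 0") (auto simp: ennreal_neg intro!: ennreal_leI)
  qed
  also have "\<dots> = ennreal C * emeasure M {x \<in> space M. \<phi> x \<noteq> 0}"
    by (rule nn_integral_cmult_indicator) measurable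
  also have "\<dots> < \<infinity>"
    using fin by (simp add: ennreal_mult_less_top)
  finally have "\<phi> \<in> orlicz_class M ?H"
    by (simp add: orlicz_class_def)
  then have space: "\<phi> \<in> orlicz_space M ?H"
    unfolding orlicz_space_def linear_hull_def
    by (intro CollectI exI[of _ "1::nat"] exI[of _ "\<lambda>_. 1"] exI[of _ "\<lambda>_. \<phi>"]) auto
  \<comment> \<open>The modular of the zero function is 0, so every \<open>l > 0\<close> is
    admissible in the infimum.\<close>
  have "orlicz_norm M ?H (\<lambda>x. \<phi> x - \<phi> x) = Inf {0<..}"
    unfolding orlicz_norm_def orlicz_modular_def
    using H0 by (intro arg_cong[where f = Inf]) (auto simp: ennreal_neg)
  also have "\<dots> = (0::real)"
    by (rule cInf_greaterThan)
  finally have norm: "orlicz_norm M ?H (\<lambda>x. \<phi> x - \<phi> x) = 0" .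
  have "\<phi> \<in> bounded_functions M"
    using bdd fin by (auto simp: bounded_functions_def)
  then show ?thesis
    using space norm unfolding orlicz_E_def by (intro CollectI conjI allI impI bexI[of _ \<phi>]) auto
qed

text \<open>Pairing with a fixed \<open>(\<phi>, \<Phi>)\<close> is one coordinate of the map that
  induces the weak* topology, hence continuous. It therefore sends the closure of the test functions
  into the closure of a subset of \<open>{0}\<close>.\<close>

lemma WsLG0_annihilator:
  assumes u: "u \<in> WsLG0 s G \<Omega>"
    and \<phi>: "\<phi> \<in> orlicz_E (lebesgue_on \<Omega>) (complementary G)"
    and \<Phi>: "\<Phi> \<in> orlicz_E mu_frac (complementary G)"
    and ann: "\<And>w. w \<in> Cc_infinity \<Omega> \<Longrightarrow>
      (\<integral>x. w x * \<phi> x \<partial>lebesgue_on \<Omega>) + (\<integral>z. D_frac s w z * \<Phi> z \<partial>mu_frac) = 0"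
  shows "(\<integral>x. u x * \<phi> x \<partial>lebesgue_on \<Omega>) + (\<integral>z. D_frac s u z * \<Phi> z \<partial>mu_frac) = 0"
proof -
  let ?P = "orlicz_E (lebesgue_on \<Omega>) (complementary G) \<times> orlicz_E mu_frac (complementary G)"
  let ?F = "\<lambda>(w, W). \<lambda>(\<phi>, \<Phi>)\<in>?P. (\<integral>x. w x * \<phi> x \<partial>lebesgue_on \<Omega>) + (\<integral>z. W z * \<Phi> z \<partial>mu_frac)"
  \<comment> \<open>Embedding, then all pairings at once, then one coordinate: in this factored form
    continuity follows from the two pullbacks.\<close>
  let ?f = "(\<lambda>k. k (\<phi>, \<Phi>)) \<circ> ?F \<circ> (\<lambda>w. (w, D_frac s w))"
  have "continuous_map (WsLG_weak_star s G \<Omega>) euclideanreal ?f"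
    unfolding WsLG_weak_star_def weak_star_topology_def Let_def
    using \<phi> \<Phi> by (intro continuous_map_pullback continuous_map_product_projection) auto
  from continuous_map_image_closure_subset[OF this, of "Cc_infinity \<Omega>"]
  have "?f u \<in> closure (?f ` Cc_infinity \<Omega>)"
    using u unfolding WsLG0_def euclidean_closure_of by (meson imageI subsetD)
  also have "closure (?f ` Cc_infinity \<Omega>) \<subseteq> {0}"
    using ann \<phi> \<Phi> by (intro closure_minimal) auto
  finally show ?thesis
    using \<phi> \<Phi> by simp
qed

lemma WsLG0_imp_WsLG:
  assumes "u \<in> WsLG0 s G \<Omega>"
  shows "u \<in> WsLG s G \<Omega>"
proof -
  have "u \<in> topspace (WsLG_weak_star s G \<Omega>)"
    using assms subsetD[OF closure_of_subset_topspace] unfolding WsLG0_def by metis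
  then show ?thesis
    by (simp add: WsLG_weak_star_def topspace_pullback_topology)
qed

section \<open>Lebesgue measure on pairs\<close>

text \<open>Allows a function to be replaced by a representative inside \<open>D_frac\<close>. The
  argument runs in \<open>lborel\<close>, since \<open>lebesgue\<close> on pairs is the completion
  of a product and not the product of completions.\<close>

lemma AE_lebesgue_pair:
  fixes P :: "'a::euclidean_space \<Rightarrow> bool"
  assumes "AE x in lebesgue. P x"
  shows "AE z in (lebesgue :: ('a \<times> 'a) measure). P (fst z) \<and> P (snd z)"
proof -
  from assms have "AE x in lborel. P x"
    by (simp add: AE_completion_iff)
  then obtain N where N: "N \<in> null_sets lborel" "{x. \<not> P x} \<subseteq> N"
    by (auto simp: eventually_ae_filter)
  have [measurable]: "N \<in> sets borel" using N by auto
  have "N \<times> UNIV \<in> null_sets (lborel \<Otimes>\<^sub>M lborel)" "UNIV \<times> N \<in> null_sets (lborel \<Otimes>\<^sub>M lborel)"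
    using N by (auto simp: null_sets_def lborel.emeasure_pair_measure_Times)
  then have null: "N \<times> UNIV \<union> UNIV \<times> N \<in> null_sets (lborel :: ('a \<times> 'a) measure)"
    unfolding lborel_prod by (rule null_sets.Un)
  have "AE z in (lborel :: ('a \<times> 'a) measure). P (fst z) \<and> P (snd z)"
    by (rule AE_I'[OF null]) (use N in auto)
  then show ?thesis
    by (simp add: AE_completion_iff)
qed

text \<open>Fubini in \<open>lborel\<close>; Borel measurability of the factors permits the passage
  between \<open>lborel\<close> and its completion.\<close>

lemma integral_lebesgue_pair:
  fixes f h :: "'a::euclidean_space \<Rightarrow> real"
  assumes f: "integrable lebesgue f" and h: "integrable lebesgue h"
    and [measurable]: "f \<in> borel_measurable borel" "h \<in> borel_measurable borel"
  shows "integrable lebesgue (\<lambda>z. f (fst z) * h (snd z))"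
    and "(\<integral>z. f (fst z) * h (snd z) \<partial>lebesgue) = (\<integral>x. f x \<partial>lebesgue) * (\<integral>x. h x \<partial>lebesgue)"
proof -
  have f': "integrable lborel f" and h': "integrable lborel h"
    using f h by (auto simp: integrable_completion)
  have *: "integrable (lborel \<Otimes>\<^sub>M lborel) (\<lambda>z. f (fst z) * h (snd z))"
    using f' h' by (intro lborel_pair.Fubini_integrable) (auto simp: abs_mult)
  then show "integrable lebesgue (\<lambda>z. f (fst z) * h (snd z))"
    by (simp add: lborel_prod integrable_completion)
  have meas: "(\<lambda>z. f (fst z) * h (snd z)) \<in> borel_measurable lborel"
    using borel_measurable_integrable[OF *] by (simp add: lborel_prod)
  from lborel_pair.integral_fst'[OF *]
  have "(\<integral>z. f (fst z) * h (snd z) \<partial>lborel) = (\<integral>x. f x \<partial>lborel) * (\<integral>x. h x \<partial>lborel)"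
    by (simp add: lborel_prod)
  then show "(\<integral>z. f (fst z) * h (snd z) \<partial>lebesgue) = (\<integral>x. f x \<partial>lebesgue) * (\<integral>x. h x \<partial>lebesgue)"
    using meas by (simp add: integral_completion)
qed

section \<open>The kernel integral over a shell\<close>

text \<open>
  Layer cake, without polar coordinates: \<open>|z| powr (- p)\<close> dominates the integral of
  \<open>p * r powr (- p - 1)\<close> over \<open>|z| \<le> r \<le> 1\<close>.
\<close>

lemma shell_integral_ge:
  fixes x :: "'a::euclidean_space"
  assumes "0 < d" "d < 1" "0 < s"
  defines "n \<equiv> real DIM('a)"
  shows "ennreal (unit_ball_vol n * (n / s * (d powr (- s) - 1) - 1)) \<le>
    (\<integral>\<^sup>+y. ennreal (dist x y powr (- (s + n))) * indicator {y. d < dist x y \<and> dist x y \<le> 1} y \<partial>lborel)"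
proof -
  let ?V = "unit_ball_vol n" and ?p = "s + n"
  let ?h = "\<lambda>r. ?p * r powr (- ?p - 1)"
  let ?S = "\<lambda>y r. d < dist x y \<and> dist x y \<le> r \<and> r \<le> 1"
  have n: "n > 0" by (simp add: n_def)
  have V: "?V \<ge> 0" using n by simp
  have "ennreal (?V * (n / s * (d powr (- s) - 1) - 1)) \<le>
      (\<integral>\<^sup>+r. ennreal (?h r * (?V * (r powr n - d powr n))) * indicator {d..1} r \<partial>lborel)"
  proof -
    \<comment> \<open>An antiderivative of the integrand: by \<open>?p = s + n\<close>, multiplying
      out leaves the powers \<open>- s - 1\<close> and \<open>- ?p - 1\<close> of
      \<open>r\<close>.\<close>
    let ?F = "\<lambda>r. ?V * (d powr n * r powr (- ?p) - ?p / s * r powr (- s))"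
    have "(\<integral>\<^sup>+r. ennreal (?h r * (?V * (r powr n - d powr n))) * indicator {d..1} r \<partial>lborel)
        = ennreal (?F 1 - ?F d)"
    proof (rule nn_integral_FTC_Icc)
      fix r assume "r \<in> {d..1}"
      then have r: "d \<le> r" "r \<le> 1" "r > 0" using assms by auto
      have "(?F has_real_derivative
          ?V * (d powr n * (- ?p * r powr (- ?p - 1)) - ?p / s * (- s * r powr (- s - 1)))) (at r)"
        using r by (auto intro!: derivative_eq_intros)
      moreover have "?V * (d powr n * (- ?p * r powr (- ?p - 1)) - ?p / s * (- s * r powr (- s - 1)))
          = ?h r * (?V * (r powr n - d powr n))"
      proof -
        have "r powr (- s - 1) = r powr (- ?p - 1) * r powr n"
          by (simp flip: powr_add)
        then show ?thesis
          using \<open>0 < s\<close> by (simp add: field_simps)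
      qed
      ultimately show "(?F has_real_derivative ?h r * (?V * (r powr n - d powr n))) (at r)"
        by (simp only:)
      show "0 \<le> ?h r * (?V * (r powr n - d powr n))"
        using r n V assms by (intro mult_nonneg_nonneg) (auto intro!: powr_mono2)
    qed (use assms in auto)
    \<comment> \<open>The surplus \<open>?V * d powr n\<close> in \<open>?F 1 - ?F d\<close> is
      discarded.\<close>
    moreover have "?V * (n / s * (d powr (- s) - 1) - 1) \<le> ?F 1 - ?F d"
    proof -
      have "d powr n * d powr (- ?p) = d powr (- s)"
        by (simp flip: powr_add)
      then have "?F 1 - ?F d = ?V * (n / s * (d powr (- s) - 1) - 1 + d powr n)"
        using \<open>0 < s\<close> by (simp add: field_simps)
      then show ?thesis using V by (simp add: mult_left_mono)
    qed
    ultimately show ?thesis by (simp add: ennreal_leI)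
  qed
  \<comment> \<open>For fixed \<open>r\<close> in \<open>{d..1}\<close> the admissible
    \<open>y\<close> form a difference of concentric balls, of volume
    \<open>?V * (r powr n - d powr n)\<close>.\<close>
  also have "\<dots> = (\<integral>\<^sup>+r. (\<integral>\<^sup>+y. ennreal (?h r) * indicator {(y, r). ?S y r} (y, r) \<partial>lborel) \<partial>lborel)"
  proof (rule nn_integral_cong)
    fix r :: real
    show "ennreal (?h r * (?V * (r powr n - d powr n))) * indicator {d..1} r =
        (\<integral>\<^sup>+y. ennreal (?h r) * indicator {(y, r). ?S y r} (y, r) \<partial>lborel)"
    proof (cases "r \<in> {d..1}")
      case True
      then have "r > 0" using assms by auto
      have "(\<integral>\<^sup>+y. ennreal (?h r) * indicator {(y, r). ?S y r} (y, r) \<partial>lborel)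
          = (\<integral>\<^sup>+y. ennreal (?h r) * indicator (cball x r - cball x d) y \<partial>lborel)"
        using True by (intro nn_integral_cong) (auto simp: indicator_def)
      also have "\<dots> = ennreal (?h r) * emeasure lborel (cball x r - cball x d)"
        by (rule nn_integral_cmult_indicator) auto
      also have "emeasure lborel (cball x r - cball x d) = ennreal (?V * r powr n) - ennreal (?V * d powr n)"
        using True assms \<open>r > 0\<close>
        by (subst emeasure_Diff) (auto simp: emeasure_cball n_def powr_realpow)
      also have "\<dots> = ennreal (?V * (r powr n - d powr n))"
        using V by (simp add: ennreal_minus right_diff_distrib)
      also have "ennreal (?h r) * \<dots> = ennreal (?h r * (?V * (r powr n - d powr n)))"
        using n assms by (intro ennreal_mult'[symmetric]) auto
      finally show ?thesis using True by simp
    next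
      case False
      then have "\<not> ?S y r" for y by auto
      with False show ?thesis by simp
    qed
  qed
  also have "\<dots> = (\<integral>\<^sup>+y. (\<integral>\<^sup>+r. ennreal (?h r) * indicator {(y, r). ?S y r} (y, r) \<partial>lborel) \<partial>lborel)"
  proof (rule lborel_pair.Fubini')
    have "{z \<in> space (lborel \<Otimes>\<^sub>M lborel). ?S (fst z) (snd z)} \<in> sets (lborel \<Otimes>\<^sub>M lborel)"
      by measurable
    then have [measurable]: "{(y, r). ?S y r} \<in> sets (lborel \<Otimes>\<^sub>M lborel)"
      by (simp add: space_pair_measure split_beta')
    show "(\<lambda>(y, r). ennreal (?h r) * indicator {(y, r). ?S y r} (y, r)) \<in> borel_measurable (lborel \<Otimes>\<^sub>M lborel)"
      by measurable
  qed
  also have "\<dots> \<le> (\<integral>\<^sup>+y. ennreal (dist x y powr (- ?p)) * indicator {y. d < dist x y \<and> dist x y \<le> 1} y \<partial>lborel)"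
  proof (rule nn_integral_mono)
    fix y :: 'a
    show "(\<integral>\<^sup>+r. ennreal (?h r) * indicator {(y, r). ?S y r} (y, r) \<partial>lborel)
        \<le> ennreal (dist x y powr (- ?p)) * indicator {y. d < dist x y \<and> dist x y \<le> 1} y"
    proof (cases "d < dist x y \<and> dist x y \<le> 1")
      case True
      have "(\<integral>\<^sup>+r. ennreal (?h r) * indicator {(y, r). ?S y r} (y, r) \<partial>lborel)
          = (\<integral>\<^sup>+r. ennreal (?h r) * indicator {dist x y..1} r \<partial>lborel)"
        using True by (intro nn_integral_cong) (auto simp: indicator_def)
      also have "\<dots> = ennreal (- (1 powr (- ?p)) - - (dist x y powr (- ?p)))"
      proof (rule nn_integral_FTC_Icc)
        fix r assume "r \<in> {dist x y..1}"
        then have "r > 0" using True assms by auto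
        then show "((\<lambda>r. - (r powr (- ?p))) has_real_derivative ?h r) (at r)"
          by (auto intro!: derivative_eq_intros simp: algebra_simps)
        show "0 \<le> ?h r" using n assms by simp
      qed (use True in auto)
      \<comment> \<open>Dropping the 1 costs the volume of the shell,
        \<open>?V * (1 - d powr n)\<close>. Together with the surplus discarded above this is the
        \<open>- 1\<close> in the constant.\<close>
      also have "\<dots> \<le> ennreal (dist x y powr (- ?p))"
        by (intro ennreal_leI) simp
      finally show ?thesis using True by simp
    next
      case False
      then have "\<not> ?S y r" for r by auto
      then show ?thesis by simp
    qed
  qed
  finally show ?thesis .
qed

section \<open>Vanishing outside \<Omega>\<close>

lemma orlicz_space_measurable:
  assumes "u \<in> orlicz_space M G"
  shows "u \<in> borel_measurable M"
proof -
  from assms obtain m :: nat and c f where f: "\<And>i. i < m \<Longrightarrow> f i \<in> orlicz_class M G"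
    and u: "u = (\<lambda>x. \<Sum>i<m. c i * f i x)"
    unfolding orlicz_space_def linear_hull_def by blast
  have "f i \<in> borel_measurable M" if "i < m" for i
    using f[OF that] by (simp add: orlicz_class_def)
  then show ?thesis
    unfolding u by (intro borel_measurable_sum borel_measurable_times) auto
qed

lemma mu_frac_eq:
  "(mu_frac :: ('a::euclidean_space \<times> 'a) measure) =
    density lebesgue (\<lambda>z. ennreal (1 / dist (fst z) (snd z) ^ DIM('a)))"
  by (simp add: mu_frac_def split_beta' dist_norm)

lemma sets_mu_frac: "sets mu_frac = sets lebesgue"
  by (simp add: mu_frac_def)

lemma borel_measurable_fst_snd [measurable]:
  "fst \<in> borel_measurable (borel :: ('a::euclidean_space \<times> 'a) measure)"
  "snd \<in> borel_measurable (borel :: ('a \<times> 'a) measure)"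
  by (auto intro!: borel_measurable_continuous_onI continuous_intros)

lemma borel_imp_lebesgue:
  "f \<in> borel_measurable borel \<Longrightarrow> f \<in> borel_measurable lebesgue"
  by (simp add: measurable_completion)

lemma D_frac_borel [measurable]:
  assumes [measurable]: "u \<in> borel_measurable borel"
  shows "D_frac s u \<in> borel_measurable borel"
  unfolding D_frac_def split_beta' by measurable

lemma integrable_bounded_indicator:
  fixes f :: "'a::euclidean_space \<Rightarrow> real"
  assumes [measurable]: "f \<in> borel_measurable borel" "S \<in> sets borel"
    and S: "bounded S" and C: "\<And>x. x \<in> S \<Longrightarrow> \<bar>f x\<bar> \<le> C"
  shows "integrable lebesgue (\<lambda>x. f x * indicator S x)"
proof -
  have "integrable lborel (\<lambda>x. C * indicator S x)"
    using emeasure_bounded_finite[OF S] by (intro integrable_mult_right integrable_real_indicator) auto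
  then have "integrable lborel (\<lambda>x. f x * indicator S x)"
    by (rule Bochner_Integration.integrable_bound)
       (use C in \<open>auto simp: indicator_def intro: order_trans[OF _ abs_ge_self]\<close>)
  then show ?thesis by (simp add: integrable_completion)
qed

text \<open>
  The kernel in \<open>\<Phi>\<close> cancels both the quotient in \<^const>\<open>D_frac\<close> and the density of
  \<^const>\<open>mu_frac\<close>, and the term over \<open>\<Omega>\<close> cancels the contribution of \<open>w\<close> on \<open>A\<close>, so that only the
  values of \<open>w\<close> on the support of \<open>\<beta>\<close> remain.
\<close>

lemma pairing_separable:
  fixes w w' :: "'a::euclidean_space \<Rightarrow> real"
  assumes D: "D_frac s w \<in> borel_measurable lebesgue"
    and w: "w \<in> borel_measurable lebesgue"
    and [measurable]: "w' \<in> borel_measurable borel" "\<beta> \<in> borel_measurable borel" "A \<in> sets borel"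
    and ae: "AE x in lebesgue. w x = w' x"
    and int: "integrable lebesgue (indicator A :: 'a \<Rightarrow> real)" "integrable lebesgue \<beta>"
      "integrable lebesgue (\<lambda>x. w' x * indicator A x)" "integrable lebesgue (\<lambda>x. w' x * \<beta> x)"
    and \<Omega>: "\<Omega> \<in> sets lebesgue" "A \<subseteq> \<Omega>"
  defines "\<Phi> \<equiv> \<lambda>z. dist (fst z) (snd z) powr (s + real DIM('a)) * (indicator A (fst z) * \<beta> (snd z))"
  shows "(\<integral>x. w x * (- (\<integral>y. \<beta> y \<partial>lebesgue) * indicator A x) \<partial>lebesgue_on \<Omega>)
      + (\<integral>z. D_frac s w z * \<Phi> z \<partial>mu_frac)
    = - measure lebesgue A * (\<integral>y. w' y * \<beta> y \<partial>lebesgue)"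
proof -
  let ?\<kappa> = "\<integral>y. \<beta> y \<partial>lebesgue" and ?I = "\<integral>x. w' x * indicator A x \<partial>lebesgue"
  let ?k = "\<lambda>z::'a \<times> 'a. 1 / dist (fst z) (snd z) ^ DIM('a)"
  have \<Phi> [measurable]: "\<Phi> \<in> borel_measurable borel"
    unfolding \<Phi>_def by measurable
  have "(\<integral>x. w x * (- ?\<kappa> * indicator A x) \<partial>lebesgue_on \<Omega>)
      = (\<integral>x. indicator \<Omega> x *\<^sub>R (w x * (- ?\<kappa> * indicator A x)) \<partial>lebesgue)"
    using \<Omega> by (intro integral_restrict_space) auto
  also have "\<dots> = (\<integral>x. - ?\<kappa> * (w' x * indicator A x) \<partial>lebesgue)"
  proof (rule integral_cong_AE)
    show "AE x in lebesgue. indicator \<Omega> x *\<^sub>R (w x * (- ?\<kappa> * indicator A x)) = - ?\<kappa> * (w' x * indicator A x)"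
      using ae by eventually_elim (use \<Omega> in \<open>auto simp: indicator_def\<close>)
    have A: "A \<in> sets lebesgue" by simp
    show "(\<lambda>x. indicator \<Omega> x *\<^sub>R (w x * (- ?\<kappa> * indicator A x))) \<in> borel_measurable lebesgue"
      using \<Omega>(1) w A
      by (intro borel_measurable_scaleR borel_measurable_times borel_measurable_indicator borel_measurable_const)
    show "(\<lambda>x. - ?\<kappa> * (w' x * indicator A x)) \<in> borel_measurable lebesgue"
      by (rule borel_imp_lebesgue) measurable
  qed
  also have "\<dots> = - ?\<kappa> * ?I" by (rule integral_mult_right_zero)
  finally have 1: "(\<integral>x. w x * (- ?\<kappa> * indicator A x) \<partial>lebesgue_on \<Omega>) = - ?\<kappa> * ?I" .
  have k: "?k \<in> borel_measurable lebesgue"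
    by (rule borel_imp_lebesgue) measurable
  have "(\<integral>z. D_frac s w z * \<Phi> z \<partial>mu_frac) = (\<integral>z. ?k z *\<^sub>R (D_frac s w z * \<Phi> z) \<partial>lebesgue)"
    unfolding mu_frac_eq using D borel_imp_lebesgue[OF \<Phi>] k
    by (intro integral_density) auto
  also have "\<dots> = (\<integral>z. w' (fst z) * indicator A (fst z) * \<beta> (snd z)
      - indicator A (fst z) * (w' (snd z) * \<beta> (snd z)) \<partial>lebesgue)"
  proof (rule integral_cong_AE)
    show "AE z in lebesgue. ?k z *\<^sub>R (D_frac s w z * \<Phi> z) =
      w' (fst z) * indicator A (fst z) * \<beta> (snd z) - indicator A (fst z) * (w' (snd z) * \<beta> (snd z))"
      using AE_lebesgue_pair[OF ae]
    proof eventually_elim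
      case (elim z)
      show ?case
      proof (cases "fst z = snd z")
        \<comment> \<open>On the diagonal \<open>D_frac\<close> is 0, and the two terms on the right
          agree.\<close>
        case True
        then show ?thesis by (simp add: D_frac_def \<Phi>_def)
      next
        case False
        then have "dist (fst z) (snd z) > 0" by simp
        then show ?thesis using elim
          by (simp add: D_frac_def \<Phi>_def split_beta' dist_norm[symmetric] powr_add powr_realpow field_simps)
      qed
    qed
    show "(\<lambda>z. ?k z *\<^sub>R (D_frac s w z * \<Phi> z)) \<in> borel_measurable lebesgue"
      using D borel_imp_lebesgue[OF \<Phi>] k
      by (intro borel_measurable_scaleR borel_measurable_times)
    show "(\<lambda>z. w' (fst z) * indicator A (fst z) * \<beta> (snd z)
      - indicator A (fst z) * (w' (snd z) * \<beta> (snd z))) \<in> borel_measurable lebesgue"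
      by (rule borel_imp_lebesgue) measurable
  qed
  also have "\<dots> = ?I * ?\<kappa> - measure lebesgue A * (\<integral>y. w' y * \<beta> y \<partial>lebesgue)"
    using integral_lebesgue_pair[OF int(3,2)] integral_lebesgue_pair[OF int(1,4)]
    by simp
  finally show ?thesis using 1 by simp
qed

text \<open>For \<open>\<beta>\<close> supported off \<open>\<Omega>\<close> the functional of
  \<open>pairing_separable\<close> vanishes on test functions, hence on \<open>u\<close>. There it
  is a nonzero multiple of the integral of \<open>u' * \<beta>\<close>, and taking
  \<open>\<beta>\<close> to be the sign of \<open>u'\<close> on a set \<open>B\<close> forces
  \<open>u' = 0\<close> almost everywhere on \<open>B\<close>.\<close>

lemma WsLG0_zero_outside:
  fixes \<Omega> :: "'a::euclidean_space set"
  assumes Y: "young_function G g" and op: "open \<Omega>" "\<Omega> \<noteq> {}" and s: "0 < s"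
    and u: "u \<in> WsLG0 s G \<Omega>"
  shows "AE x in lebesgue. x \<notin> \<Omega> \<longrightarrow> u x = 0"
proof -
  have um: "u \<in> borel_measurable lebesgue" and Du: "D_frac s u \<in> borel_measurable lebesgue"
    using WsLG0_imp_WsLG[OF u] orlicz_space_measurable[of "D_frac s u" mu_frac G]
    by (auto simp: WsLG_def measurable_cong_sets[OF sets_mu_frac refl])
  obtain u' where u'[measurable]: "u' \<in> borel_measurable borel" and "AE x in lborel. u x = u' x"
    using completion_ex_borel_measurable_real[OF um] by auto
  then have ae: "AE x in lebesgue. u x = u' x"
    by (simp add: AE_completion_iff)
  have \<Omega>: "\<Omega> \<in> sets lebesgue" using op by simp
  obtain p e where e: "e > 0" "ball p e \<subseteq> \<Omega>"
    using op by (metis open_contains_ball ex_in_conv)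
  \<comment> \<open>Halving the radius leaves a gap of width \<open>r\<close> between
    \<open>ball p r\<close>, which will contain \<open>A\<close>, and the complement of
    \<open>\<Omega>\<close>.\<close>
  define r where "r = e / 2"
  have r: "r > 0" "ball p (2 * r) \<subseteq> \<Omega>" using e by (auto simp: r_def)
  \<comment> \<open>Bounding the values makes \<open>u'\<close> integrable on the set. The sets
    exhaust \<open>ball p r\<close>, so one of them has positive measure.\<close>
  define AN where "AN N = ball p r \<inter> {x. \<bar>u' x\<bar> \<le> real N}" for N :: nat
  have AN [measurable]: "AN N \<in> sets borel" for N
    unfolding AN_def by measurable
  obtain N where N: "emeasure lborel (AN N) \<noteq> 0"
  proof (rule ccontr)
    assume "\<not> thesis"
    then have "AN N \<in> null_sets lborel" for N
      using that by (auto simp: null_sets_def)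
    then have "(\<Union>N. AN N) \<in> null_sets lborel" by (rule null_sets_UN)
    moreover have "(\<Union>N. AN N) = ball p r"
      using real_arch_simple by (auto simp: AN_def)
    ultimately show False
      using r unit_ball_vol_pos[of "real DIM('a)"] by (simp add: null_sets_def emeasure_ball)
  qed
  define A where "A = AN N"
  have [measurable]: "A \<in> sets borel" by (simp add: A_def)
  have Asub: "A \<subseteq> ball p r" and Abd: "\<And>x. x \<in> A \<Longrightarrow> \<bar>u' x\<bar> \<le> real N"
    by (auto simp: A_def AN_def)
  have "ball p r \<subseteq> ball p (2 * r)" using r by (intro subset_ball) auto
  then have A\<Omega>: "A \<subseteq> \<Omega>" using Asub r by blast
  have Ab: "bounded A" by (rule bounded_subset[OF bounded_ball Asub])
  have intA: "integrable lebesgue (indicator A :: 'a \<Rightarrow> real)"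
    and mA: "measure lebesgue A > 0"
  proof -
    have fin: "emeasure lborel A < \<infinity>" by (rule emeasure_bounded_finite[OF Ab])
    then show "integrable lebesgue (indicator A :: 'a \<Rightarrow> real)"
      by (simp add: integrable_completion)
    show "measure lebesgue A > 0"
      using fin N by (simp add: A_def measure_def zero_less_iff_neq_zero enn2real_positive_iff less_top)
  qed
  have "AE x in lebesgue. x \<in> cball p (real k) - \<Omega> \<and> \<bar>u' x\<bar> \<le> real k \<longrightarrow> u' x = 0" for k :: nat
  proof -
    \<comment> \<open>Bounded in space and in the values of \<open>u'\<close>, so that all integrals
      are finite; letting \<open>k\<close> grow exhausts the complement of
      \<open>\<Omega>\<close>.\<close>
    define B where "B = (cball p (real k) - \<Omega>) \<inter> {x. \<bar>u' x\<bar> \<le> real k}"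
    have [measurable]: "B \<in> sets borel"
      unfolding B_def using op by measurable
    define \<beta> where "\<beta> = (\<lambda>y. sgn (u' y) * indicator B y)"
    have [measurable]: "\<beta> \<in> borel_measurable borel"
      unfolding \<beta>_def by measurable
    have \<beta>1: "\<bar>\<beta> y\<bar> \<le> 1" for y by (auto simp: \<beta>_def indicator_def sgn_if)
    have Bbd: "\<bar>u' y\<bar> \<le> real k" if "y \<in> B" for y
      using that by (simp add: B_def)
    have Bsub: "B \<subseteq> cball p (real k)" by (auto simp: B_def)
    have Bb: "bounded B" by (rule bounded_subset[OF bounded_cball Bsub])
    have int\<beta>: "integrable lebesgue \<beta>"
      unfolding \<beta>_def by (rule integrable_bounded_indicator[OF _ _ Bb, where C = 1]) (auto simp: sgn_if)
    let ?\<kappa> = "\<integral>y. \<beta> y \<partial>lebesgue"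
    define \<phi> where "\<phi> = (\<lambda>x. - ?\<kappa> * indicator A x)"
    define \<Phi> where "\<Phi> = (\<lambda>z. dist (fst z) (snd z) powr (s + real DIM('a)) * (indicator A (fst z) * \<beta> (snd z)))"
    have \<Phi>m [measurable]: "\<Phi> \<in> borel_measurable borel"
      unfolding \<Phi>_def by measurable
    have \<phi>E: "\<phi> \<in> orlicz_E (lebesgue_on \<Omega>) (complementary G)"
    proof (rule bounded_in_orlicz_E[OF Y])
      show "\<phi> \<in> borel_measurable (lebesgue_on \<Omega>)"
        by (rule measurable_restrict_space1, rule borel_imp_lebesgue) (simp add: \<phi>_def)
      show "\<bar>\<phi> x\<bar> \<le> \<bar>?\<kappa>\<bar>" for x by (auto simp: \<phi>_def indicator_def)
      have "emeasure (lebesgue_on \<Omega>) {x \<in> space (lebesgue_on \<Omega>). \<phi> x \<noteq> 0} \<le> emeasure (lebesgue_on \<Omega>) A"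
        using \<Omega> A\<Omega> by (intro emeasure_mono) (auto simp: \<phi>_def indicator_def sets_restrict_space_iff split: if_splits)
      also have "\<dots> = emeasure lborel A"
        using \<Omega> A\<Omega> by (simp add: emeasure_restrict_space)
      also have "\<dots> < \<infinity>"
        by (rule emeasure_bounded_finite[OF Ab])
      finally show "emeasure (lebesgue_on \<Omega>) {x \<in> space (lebesgue_on \<Omega>). \<phi> x \<noteq> 0} < \<infinity>" .
    qed
    \<comment> \<open>The lower bound keeps the density of \<open>mu_frac\<close> below
      \<open>1 / r ^ DIM('a)\<close> on the support of \<open>\<Phi>\<close>; the upper bound keeps
      \<open>\<Phi>\<close> itself bounded.\<close>
    have dist: "r \<le> dist x y" "dist x y \<le> r + real k" if "x \<in> A" "y \<in> B" for x y
    proof -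
      have "dist p x < r" using that Asub by auto
      moreover have "y \<notin> ball p (2 * r)" using that r by (auto simp: B_def)
      moreover have "dist p y \<le> real k" using that by (auto simp: B_def)
      ultimately show "r \<le> dist x y" "dist x y \<le> r + real k"
        using dist_triangle[of p y x] dist_triangle[of x y p] by (auto simp: dist_commute)
    qed
    have \<Phi>0: "fst z \<in> A \<and> snd z \<in> B" if "\<Phi> z \<noteq> 0" for z
      using that by (auto simp: \<Phi>_def \<beta>_def indicator_def split: if_splits)
    have \<Phi>E: "\<Phi> \<in> orlicz_E mu_frac (complementary G)"
    proof (rule bounded_in_orlicz_E[OF Y])
      show "\<Phi> \<in> borel_measurable mu_frac"
        using borel_imp_lebesgue[OF \<Phi>m] by (simp add: measurable_cong_sets[OF sets_mu_frac refl])
      show "\<bar>\<Phi> z\<bar> \<le> (r + real k) powr (s + real DIM('a))" for z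
      proof (cases "\<Phi> z = 0")
        case False
        note AB = \<Phi>0[OF this]
        have "\<bar>\<Phi> z\<bar> \<le> dist (fst z) (snd z) powr (s + real DIM('a)) * 1"
          unfolding \<Phi>_def abs_mult using \<beta>1[of "snd z"] AB by (intro mult_mono) auto
        also have "\<dots> \<le> (r + real k) powr (s + real DIM('a))"
          using dist AB s by (simp add: powr_mono2)
        finally show ?thesis .
      qed simp
      let ?S = "{z \<in> space mu_frac. \<Phi> z \<noteq> 0}"
      have S: "?S = {z. \<Phi> z \<noteq> 0}" by (simp add: mu_frac_eq)
      have Sb: "{z. \<Phi> z \<noteq> 0} \<in> sets borel" by measurable
      have "emeasure mu_frac ?S
          = (\<integral>\<^sup>+z. ennreal (1 / dist (fst z) (snd z) ^ DIM('a)) * indicator {z. \<Phi> z \<noteq> 0} z \<partial>lebesgue)"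
        unfolding S unfolding mu_frac_eq using Sb
        by (intro emeasure_density) (auto intro!: borel_imp_lebesgue)
      also have "\<dots> \<le> (\<integral>\<^sup>+z. ennreal (1 / r ^ DIM('a)) * indicator {z. \<Phi> z \<noteq> 0} z \<partial>lebesgue)"
      proof (intro nn_integral_mono)
        fix z :: "'a \<times> 'a"
        show "ennreal (1 / dist (fst z) (snd z) ^ DIM('a)) * indicator {z. \<Phi> z \<noteq> 0} z
          \<le> ennreal (1 / r ^ DIM('a)) * indicator {z. \<Phi> z \<noteq> 0} z"
        proof (cases "\<Phi> z = 0")
          case False
          then have "r \<le> dist (fst z) (snd z)" using \<Phi>0 dist by blast
          then have "1 / dist (fst z) (snd z) ^ DIM('a) \<le> 1 / r ^ DIM('a)"
            using r by (intro divide_left_mono power_mono mult_pos_pos zero_less_power) linarith+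
          then show ?thesis using False by (simp add: ennreal_leI)
        qed simp
      qed
      also have "\<dots> = ennreal (1 / r ^ DIM('a)) * emeasure lborel {z. \<Phi> z \<noteq> 0}"
        using Sb by (simp add: nn_integral_completion nn_integral_cmult_indicator)
      also have "\<dots> < \<infinity>"
      proof -
        have "{z. \<Phi> z \<noteq> 0} \<subseteq> ball p r \<times> cball p (real k)"
          using \<Phi>0 Asub Bsub by (auto simp: subset_iff mem_Times_iff)
        then have "bounded {z. \<Phi> z \<noteq> 0}"
          by (rule bounded_subset[rotated]) (intro bounded_Times bounded_ball bounded_cball)
        then show ?thesis
          using emeasure_bounded_finite by (auto simp: ennreal_mult_less_top)
      qed
      finally show "emeasure mu_frac ?S < \<infinity>" .
    qed
    have pair: "(\<integral>x. w x * \<phi> x \<partial>lebesgue_on \<Omega>) + (\<integral>z. D_frac s w z * \<Phi> z \<partial>mu_frac)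
        = - measure lebesgue A * (\<integral>y. w' y * \<beta> y \<partial>lebesgue)"
      if "D_frac s w \<in> borel_measurable lebesgue" "w \<in> borel_measurable lebesgue"
        "w' \<in> borel_measurable borel" "AE x in lebesgue. w x = w' x"
        "integrable lebesgue (\<lambda>x. w' x * indicator A x)" "integrable lebesgue (\<lambda>x. w' x * \<beta> x)" for w w'
      unfolding \<phi>_def \<Phi>_def by (intro pairing_separable that intA int\<beta> \<Omega> A\<Omega>) auto
    have "(\<integral>x. u x * \<phi> x \<partial>lebesgue_on \<Omega>) + (\<integral>z. D_frac s u z * \<Phi> z \<partial>mu_frac) = 0"
    proof (rule WsLG0_annihilator[OF u \<phi>E \<Phi>E])
      fix w assume w: "w \<in> Cc_infinity \<Omega>"
      then have "Ck 0 w" by (auto simp: Cc_infinity_def)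
      then have cont: "continuous_on UNIV w" by simp
      then have wm [measurable]: "w \<in> borel_measurable borel"
        by (rule borel_measurable_continuous_onI)
      have "closure {x. w x \<noteq> 0} \<subseteq> \<Omega>"
        using w by (simp add: Cc_infinity_def)
      then have "{x. w x \<noteq> 0} \<subseteq> \<Omega>"
        by (rule order_trans[OF closure_subset])
      then have w0: "w y = 0" if "y \<notin> \<Omega>" for y
        using that by blast
      \<comment> \<open>\<open>B\<close> misses \<open>\<Omega>\<close>, so the right-hand side of
        \<open>pair\<close> is 0 for a test function.\<close>
      then have w\<beta>: "(\<lambda>y. w y * \<beta> y) = (\<lambda>y. 0)"
        by (auto simp: \<beta>_def B_def indicator_def fun_eq_iff)
      have "compact (w ` cball p r)"
        using cont by (intro compact_continuous_image continuous_on_subset[OF cont]) auto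
      then obtain C where C: "\<And>x. x \<in> cball p r \<Longrightarrow> \<bar>w x\<bar> \<le> C"
        by (metis compact_imp_bounded bounded_iff imageI real_norm_def)
      show "(\<integral>x. w x * \<phi> x \<partial>lebesgue_on \<Omega>) + (\<integral>z. D_frac s w z * \<Phi> z \<partial>mu_frac) = 0"
      proof (subst pair)
        show "integrable lebesgue (\<lambda>x. w x * indicator A x)"
          by (rule integrable_bounded_indicator[OF _ _ Ab, where C = C]) (use C Asub in auto)
      qed (auto simp: w\<beta> intro!: borel_imp_lebesgue)
    qed
    moreover have u\<beta>: "u' y * \<beta> y = \<bar>u' y\<bar> * indicator B y" for y
      by (simp add: \<beta>_def abs_sgn mult.assoc)
    have intu: "integrable lebesgue (\<lambda>y. \<bar>u' y\<bar> * indicator B y)"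
      by (rule integrable_bounded_indicator[OF _ _ Bb, where C = "real k"]) (use Bbd in auto)
    have "(\<integral>x. u x * \<phi> x \<partial>lebesgue_on \<Omega>) + (\<integral>z. D_frac s u z * \<Phi> z \<partial>mu_frac)
        = - measure lebesgue A * (\<integral>y. u' y * \<beta> y \<partial>lebesgue)"
    proof (rule pair[OF Du um u' ae])
      show "integrable lebesgue (\<lambda>x. u' x * indicator A x)"
        by (rule integrable_bounded_indicator[OF _ _ Ab, where C = "real N"]) (use Abd in auto)
      show "integrable lebesgue (\<lambda>x. u' x * \<beta> x)"
        unfolding u\<beta> by (rule intu)
    qed
    ultimately have "(\<integral>y. \<bar>u' y\<bar> * indicator B y \<partial>lebesgue) = 0"
      using mA by (simp add: u\<beta>)
    then have "AE y in lebesgue. \<bar>u' y\<bar> * indicator B y = 0"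
      using integral_nonneg_eq_0_iff_AE[OF intu] by simp
    then show ?thesis
      by eventually_elim (auto simp: B_def indicator_def split: if_splits)
  qed
  \<comment> \<open>Countably many null sets are united before \<open>k\<close> is chosen depending
    on \<open>x\<close>.\<close>
  then have "AE x in lebesgue. \<forall>k::nat. x \<in> cball p (real k) - \<Omega> \<and> \<bar>u' x\<bar> \<le> real k \<longrightarrow> u' x = 0"
    by (intro iffD2[OF AE_all_countable] allI)
  with ae show ?thesis
  proof eventually_elim
    case (elim x)
    obtain k :: nat where "max (dist p x) \<bar>u' x\<bar> \<le> real k"
      using real_arch_simple by blast
    with elim show ?case by auto
  qed
qed

section \<open>Lower bound for the double integral\<close>

text \<open>The values of \<open>g\<close> at negative arguments are arbitrary, so measurability
  comes from the monotone function \<open>g (max t 0)\<close>, which agrees with \<open>g\<close> on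
  the closed half line.\<close>

lemma young_deriv_abs_borel:
  assumes "young_function G g"
  shows "(\<lambda>t. g \<bar>t\<bar>) \<in> borel_measurable borel"
proof -
  have "mono (\<lambda>t. g (max t 0))"
    by (intro monoI young_deriv_mono[OF assms]) auto
  then have [measurable]: "(\<lambda>t. g (max t 0)) \<in> borel_measurable borel"
    by (rule borel_measurable_mono)
  have "(\<lambda>t. g (max \<bar>t\<bar> 0)) \<in> borel_measurable borel"
    by measurable
  then show ?thesis by simp
qed

text \<open>With nonnegative integrals, Tonelli reduces the claim to comparing integrands in
  \<open>y\<close> for fixed \<open>x\<close>, on the shell of
  \<open>shell_integral_ge\<close>.\<close>

lemma double_integral_ge:
  fixes u :: "'a::euclidean_space \<Rightarrow> real"
  assumes Y: "young_function G g" and [measurable]: "u \<in> borel_measurable borel"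
    and zero: "\<And>x. x \<notin> \<Omega> \<Longrightarrow> u x = 0"
    and diam: "\<And>x y. x \<in> \<Omega> \<Longrightarrow> y \<in> \<Omega> \<Longrightarrow> dist x y \<le> d"
    and d: "0 < d" "d < 1" and s: "0 < s"
  defines "n \<equiv> real DIM('a)"
  shows "ennreal (unit_ball_vol n * (n / s * (d powr (- s) - 1) - 1))
      * (\<integral>\<^sup>+x. ennreal (g \<bar>u x\<bar> * \<bar>u x\<bar>) \<partial>lborel)
    \<le> (\<integral>\<^sup>+z. ennreal (1 / dist (fst z) (snd z) ^ DIM('a))
        * ennreal (g \<bar>D_frac s u z\<bar> * \<bar>D_frac s u z\<bar>) \<partial>lborel)"
proof -
  let ?c = "ennreal (unit_ball_vol n * (n / s * (d powr (- s) - 1) - 1))"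
  let ?e = "\<lambda>z. ennreal (1 / dist (fst z) (snd z) ^ DIM('a))
        * ennreal (g \<bar>D_frac s u z\<bar> * \<bar>D_frac s u z\<bar>)"
  have gm [measurable]: "(\<lambda>t. g \<bar>t\<bar>) \<in> borel_measurable borel"
    by (rule young_deriv_abs_borel[OF Y])
  have gu [measurable]: "(\<lambda>x. g \<bar>u x\<bar>) \<in> borel_measurable borel"
    using measurable_compose[OF _ gm, of u borel] by simp
  have gD [measurable]: "(\<lambda>z. g \<bar>D_frac s u z\<bar>) \<in> borel_measurable borel"
    using measurable_compose[OF _ gm, of "D_frac s u" borel] by simp
  have g0: "g t \<ge> 0" if "t \<ge> 0" for t
    using Y that by (simp add: young_function_def)
  have "?c * (\<integral>\<^sup>+x. ennreal (g \<bar>u x\<bar> * \<bar>u x\<bar>) \<partial>lborel) = (\<integral>\<^sup>+x. ?c * ennreal (g \<bar>u x\<bar> * \<bar>u x\<bar>) \<partial>lborel)"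
    by (rule nn_integral_cmult[symmetric]) measurable
  also have "\<dots> \<le> (\<integral>\<^sup>+x. (\<integral>\<^sup>+y. ?e (x, y) \<partial>lborel) \<partial>lborel)"
  proof (rule nn_integral_mono)
    fix x :: 'a
    show "?c * ennreal (g \<bar>u x\<bar> * \<bar>u x\<bar>) \<le> (\<integral>\<^sup>+y. ?e (x, y) \<partial>lborel)"
    proof (cases "u x = 0")
      case False
      let ?S = "{y. d < dist x y \<and> dist x y \<le> 1}"
      have [measurable]: "?S \<in> sets borel" by measurable
      have "?c * ennreal (g \<bar>u x\<bar> * \<bar>u x\<bar>)
          \<le> (\<integral>\<^sup>+y. ennreal (dist x y powr (- (s + n))) * indicator ?S y \<partial>lborel) * ennreal (g \<bar>u x\<bar> * \<bar>u x\<bar>)"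
        unfolding n_def using d s by (intro mult_right_mono shell_integral_ge) auto
      also have "\<dots> = (\<integral>\<^sup>+y. ennreal (dist x y powr (- (s + n))) * indicator ?S y * ennreal (g \<bar>u x\<bar> * \<bar>u x\<bar>) \<partial>lborel)"
        by (rule nn_integral_multc[symmetric]) measurable
      also have "\<dots> \<le> (\<integral>\<^sup>+y. ?e (x, y) \<partial>lborel)"
      proof (rule nn_integral_mono)
        fix y :: 'a
        show "ennreal (dist x y powr (- (s + n))) * indicator ?S y * ennreal (g \<bar>u x\<bar> * \<bar>u x\<bar>) \<le> ?e (x, y)"
        proof (cases "y \<in> ?S")
          case True
          \<comment> \<open>\<open>u x \<noteq> 0\<close> puts \<open>x\<close> in
            \<open>\<Omega>\<close>, and a point \<open>y\<close> of \<open>\<Omega>\<close> would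
            lie within distance \<open>d\<close> of it.\<close>
          have "u y = 0"
            using True zero[of x] zero[of y] diam[of x y] False by force
          define \<rho> where "\<rho> = dist x y"
          have \<rho>: "0 < \<rho>" "\<rho> \<le> 1" using True d by (auto simp: \<rho>_def)
          have D: "\<bar>D_frac s u (x, y)\<bar> = \<bar>u x\<bar> / \<rho> powr s"
            using \<open>u y = 0\<close> by (simp add: D_frac_def \<rho>_def dist_norm)
          have "\<rho> powr s \<le> 1" using \<rho> s by (simp add: powr_le1)
          then have "\<bar>u x\<bar> \<le> \<bar>u x\<bar> / \<rho> powr s"
            using \<rho> by (simp add: field_simps mult_left_le)
          then have "g \<bar>u x\<bar> \<le> g (\<bar>u x\<bar> / \<rho> powr s)"
            by (intro young_deriv_mono[OF Y]) auto
          then have "\<rho> powr (- (s + n)) * (g \<bar>u x\<bar> * \<bar>u x\<bar>)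
              \<le> \<rho> powr (- (s + n)) * (g (\<bar>u x\<bar> / \<rho> powr s) * \<bar>u x\<bar>)"
            by (intro mult_left_mono mult_right_mono) auto
          \<comment> \<open>The factor \<open>\<rho> powr (- s)\<close> of the kernel turns the
            remaining \<open>\<bar>u x\<bar>\<close> into the second difference quotient.\<close>
          also have "\<dots> = 1 / \<rho> ^ DIM('a) * (g (\<bar>u x\<bar> / \<rho> powr s) * (\<bar>u x\<bar> / \<rho> powr s))"
          proof -
            have "\<rho> powr (- (s + n)) = 1 / (\<rho> powr s * \<rho> ^ DIM('a))"
              using \<rho> by (simp only: n_def powr_minus powr_add powr_realpow inverse_eq_divide)
            then show ?thesis by simp
          qed
          finally have "\<rho> powr (- (s + n)) * (g \<bar>u x\<bar> * \<bar>u x\<bar>)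
              \<le> 1 / \<rho> ^ DIM('a) * (g \<bar>D_frac s u (x, y)\<bar> * \<bar>D_frac s u (x, y)\<bar>)"
            by (simp add: D)
          from ennreal_leI[OF this] True show ?thesis
            using g0 by (simp add: \<rho>_def flip: ennreal_mult)
        qed simp
      qed
      finally show ?thesis .
    qed simp
  qed
  also have "\<dots> = (\<integral>\<^sup>+z. ?e z \<partial>(lborel \<Otimes>\<^sub>M lborel))"
    by (rule lborel.nn_integral_fst) (simp add: lborel_prod)
  finally show ?thesis by (simp add: lborel_prod)
qed

section \<open>The condition on the diameter\<close>

text \<open>Raising the condition to the power \<open>s\<close> gives
  \<open>m * d powr (- s) \<ge> 2 * (1 + \<epsilon>)\<close>, and \<open>m \<le> 1\<close> then
  gives \<open>m * (d powr (- s) - 2) \<ge> 2 * \<epsilon>\<close>. The estimates in fact yield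
  \<open>4 * \<epsilon>\<close>.\<close>

lemma diameter_condition_imp:
  fixes d s \<epsilon> V n :: real
  assumes d: "0 < d" and s: "0 < s" "s < 1" and "\<epsilon> > 0" and V: "V > 0" and n: "n \<ge> 1"
    and le: "d \<le> (1 / (2 * (1 + \<epsilon>)) * min 1 (n * V / (2 * s))) powr (1 / s)"
  shows "d < 1" and "\<epsilon> \<le> V * (n / s * (d powr (- s) - 1) - 1)"
proof -
  define P where "P = n * V / (2 * s)"
  define m where "m = min 1 P"
  define X where "X = 1 / (2 * (1 + \<epsilon>)) * m"
  have P: "P > 0" using assms by (simp add: P_def)
  then have m: "0 < m" "m \<le> 1" "m \<le> P" by (auto simp: m_def)
  have X: "0 < X" "X < 1"
    using m \<open>\<epsilon> > 0\<close> by (auto simp: X_def field_simps)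
  have "d powr s \<le> (X powr (1 / s)) powr s"
    using le d s by (intro powr_mono2) (auto simp: X_def m_def P_def)
  then have dX: "d powr s \<le> X" using X s by (simp add: powr_powr)
  show "d < 1"
  proof (rule ccontr)
    assume "\<not> d < 1"
    then have "1 \<le> d powr s" using s by (simp add: ge_one_powr_ge_zero)
    then show False using dX X by simp
  qed
  have "2 * (1 + \<epsilon>) / m = 1 / X" using m by (simp add: X_def)
  also have "\<dots> \<le> 1 / d powr s"
    using dX d X by (intro divide_left_mono) auto
  also have "\<dots> = d powr (- s)" by (simp add: powr_minus divide_inverse)
  finally have D: "2 * (1 + \<epsilon>) \<le> m * d powr (- s)"
    using m by (simp add: field_simps)
  \<comment> \<open>Because \<open>s < 1 \<le> n\<close>; this absorbs the final \<open>- V\<close>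
    of the constant into a second multiple of \<open>2 * P\<close>.\<close>
  have "V \<le> 2 * P"
    using s n V mult_mono[of s n V V] by (simp add: P_def field_simps)
  moreover have "V * (n / s * (d powr (- s) - 1) - 1) = 2 * P * (d powr (- s) - 1) - V"
    using s by (simp add: P_def field_simps)
  ultimately have "V * (n / s * (d powr (- s) - 1) - 1) \<ge> 2 * (P * (d powr (- s) - 2))"
    by (simp add: algebra_simps)
  moreover have "2 * \<epsilon> \<le> m * (d powr (- s) - 2)"
    using D m by (simp add: algebra_simps)
  \<comment> \<open>The sign is needed to replace \<open>m\<close> by the larger
    \<open>P\<close>.\<close>
  moreover from this have "0 \<le> d powr (- s) - 2"
    using m \<open>\<epsilon> > 0\<close> by (smt (verit) zero_less_mult_pos)
  then have "m * (d powr (- s) - 2) \<le> P * (d powr (- s) - 2)"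
    using m by (intro mult_right_mono) auto
  ultimately show "\<epsilon> \<le> V * (n / s * (d powr (- s) - 1) - 1)"
    using \<open>\<epsilon> > 0\<close> by linarith
qed

section \<open>The eigenvalue bound\<close>

text \<open>Testing with \<open>u\<close> and applying \<open>double_integral_ge\<close> bounds
  \<open>l\<close> times the integral of \<open>b\<close> from below by the constant times the same
  integral; the condition on \<open>energy_J\<close> makes that integral positive, so it can be
  divided out.\<close>

lemma weak_solution_eigenvalue_ge:
  fixes \<Omega> :: "'a::euclidean_space set"
  assumes Y: "young_function G g" and op: "open \<Omega>" "\<Omega> \<noteq> {}"
    and diam: "\<And>x y. x \<in> \<Omega> \<Longrightarrow> y \<in> \<Omega> \<Longrightarrow> dist x y \<le> d"
    and d: "0 < d" "d < 1" and s: "0 < s"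
    and sol: "weak_solution s G g \<Omega> l u" and J: "energy_J G \<Omega> u \<noteq> 0"
  defines "n \<equiv> real DIM('a)"
  shows "unit_ball_vol n * (n / s * (d powr (- s) - 1) - 1) \<le> l"
proof -
  let ?c = "unit_ball_vol n * (n / s * (d powr (- s) - 1) - 1)"
  define a where "a = (\<lambda>z. g \<bar>D_frac s u z\<bar> * \<bar>D_frac s u z\<bar>)"
  define b where "b = (\<lambda>x. g \<bar>u x\<bar> * \<bar>u x\<bar>)"
  have g0: "g t \<ge> 0" if "t \<ge> 0" for t
    using Y that by (simp add: young_function_def)
  \<comment> \<open>Also valid at \<open>t = 0\<close>, where both sides are 0.\<close>
  have sgn: "q * (t / \<bar>t\<bar>) * t = q * \<bar>t\<bar>" for q t :: real
    by (simp add: abs_if)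
  have u: "u \<in> WsLG0 s G \<Omega>" using sol by (simp add: weak_solution_def)
  with sol have "\<forall>v\<in>WsLG0 s G \<Omega>.
      let a = (\<lambda>z. g \<bar>D_frac s u z\<bar> * (D_frac s u z / \<bar>D_frac s u z\<bar>) * D_frac s v z);
          b = (\<lambda>x. g \<bar>u x\<bar> * (u x / \<bar>u x\<bar>) * v x)
      in integrable mu_frac a \<and> integrable (lebesgue_on \<Omega>) b \<and>
        integral\<^sup>L mu_frac a = l * integral\<^sup>L (lebesgue_on \<Omega>) b"
    by (simp add: weak_solution_def)
  from bspec[OF this u, unfolded Let_def sgn] have a: "integrable mu_frac a" and b: "integrable (lebesgue_on \<Omega>) b"
    and eq: "integral\<^sup>L mu_frac a = l * integral\<^sup>L (lebesgue_on \<Omega>) b"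
    by (simp_all only: a_def b_def)
  have a0: "a z \<ge> 0" and b0: "b x \<ge> 0" for z x
    using g0 by (auto simp: a_def b_def)
  have um: "u \<in> borel_measurable lebesgue"
    using WsLG0_imp_WsLG[OF u] by (simp add: WsLG_def)
  obtain u' where [measurable]: "u' \<in> borel_measurable borel" and "AE x in lborel. u x = u' x"
    using completion_ex_borel_measurable_real[OF um] by auto
  then have ae': "AE x in lebesgue. u x = u' x"
    by (simp add: AE_completion_iff)
  \<comment> \<open>A Borel representative that vanishes at every point outside
    \<open>\<Omega>\<close>, not just almost everywhere, as \<open>double_integral_ge\<close>
    requires.\<close>
  define U where "U x = u' x * indicator \<Omega> x" for x
  have [measurable]: "\<Omega> \<in> sets borel" using op by simp
  have U [measurable]: "U \<in> borel_measurable borel"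
    unfolding U_def by measurable
  have U0: "U x = 0" if "x \<notin> \<Omega>" for x using that by (simp add: U_def)
  have ae: "AE x in lebesgue. u x = U x"
    using ae' WsLG0_zero_outside[OF Y op s u]
    by eventually_elim (auto simp: U_def indicator_def)
  have "ennreal (integral\<^sup>L (lebesgue_on \<Omega>) b) = (\<integral>\<^sup>+x. ennreal (b x) \<partial>lebesgue_on \<Omega>)"
    using b b0 by (intro nn_integral_eq_integral[symmetric]) auto
  also have "\<dots> = (\<integral>\<^sup>+x. ennreal (b x) * indicator \<Omega> x \<partial>lebesgue)"
    using op by (intro nn_integral_restrict_space) auto
  also have "\<dots> = (\<integral>\<^sup>+x. ennreal (g \<bar>U x\<bar> * \<bar>U x\<bar>) \<partial>lebesgue)"
    using ae by (intro nn_integral_cong_AE, eventually_elim) (auto simp: b_def U_def indicator_def)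
  also have "\<dots> = (\<integral>\<^sup>+x. ennreal (g \<bar>U x\<bar> * \<bar>U x\<bar>) \<partial>lborel)"
    by (rule nn_integral_completion)
  finally have B: "(\<integral>\<^sup>+x. ennreal (g \<bar>U x\<bar> * \<bar>U x\<bar>) \<partial>lborel) = ennreal (integral\<^sup>L (lebesgue_on \<Omega>) b)" ..
  have "ennreal (l * integral\<^sup>L (lebesgue_on \<Omega>) b) = (\<integral>\<^sup>+z. ennreal (a z) \<partial>mu_frac)"
    unfolding eq[symmetric] using a a0 by (intro nn_integral_eq_integral[symmetric]) auto
  also have "\<dots> = (\<integral>\<^sup>+z. ennreal (1 / dist (fst z) (snd z) ^ DIM('a)) * ennreal (a z) \<partial>lebesgue)"
  proof -
    have "a \<in> borel_measurable lebesgue"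
      using borel_measurable_integrable[OF a] by (simp add: measurable_cong_sets[OF sets_mu_frac refl])
    then show ?thesis
      unfolding mu_frac_eq
      by (intro nn_integral_density) (auto intro!: borel_imp_lebesgue)
  qed
  also have "\<dots> = (\<integral>\<^sup>+z. ennreal (1 / dist (fst z) (snd z) ^ DIM('a))
      * ennreal (g \<bar>D_frac s U z\<bar> * \<bar>D_frac s U z\<bar>) \<partial>lebesgue)"
    using AE_lebesgue_pair[OF ae]
    by (intro nn_integral_cong_AE, eventually_elim) (auto simp: a_def D_frac_def split_beta')
  also have "\<dots> = (\<integral>\<^sup>+z. ennreal (1 / dist (fst z) (snd z) ^ DIM('a))
      * ennreal (g \<bar>D_frac s U z\<bar> * \<bar>D_frac s U z\<bar>) \<partial>lborel)"
    by (rule nn_integral_completion)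
  finally have le: "ennreal ?c * ennreal (integral\<^sup>L (lebesgue_on \<Omega>) b)
      \<le> ennreal (l * integral\<^sup>L (lebesgue_on \<Omega>) b)"
    using double_integral_ge[OF Y U U0 diam d s] by (simp add: B n_def)
  \<comment> \<open>Otherwise \<open>u = 0\<close> almost everywhere on \<open>\<Omega>\<close>, as
    \<open>g\<close> is positive on positive arguments, and then \<open>energy_J\<close> would be
    0.\<close>
  have pos: "integral\<^sup>L (lebesgue_on \<Omega>) b > 0"
  proof (rule ccontr)
    assume "\<not> ?thesis"
    moreover have "integral\<^sup>L (lebesgue_on \<Omega>) b \<ge> 0" using b0 by simp
    ultimately have "AE x in lebesgue_on \<Omega>. b x = 0"
      using integral_nonneg_eq_0_iff_AE[OF b] b0 by simp
    then have "AE x in lebesgue_on \<Omega>. u x = 0"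
    proof eventually_elim
      case (elim x)
      have "\<bar>u x\<bar> > 0 \<Longrightarrow> g \<bar>u x\<bar> > 0"
        using Y unfolding young_function_def by blast
      with elim show ?case by (cases "u x = 0") (auto simp: b_def)
    qed
    then have "AE x in lebesgue_on \<Omega>. ennreal (G \<bar>u x\<bar>) = 0"
      by eventually_elim (simp add: young_zero[OF Y])
    then have "energy_J G \<Omega> u = (\<integral>\<^sup>+x. 0 \<partial>lebesgue_on \<Omega>)"
      unfolding energy_J_def orlicz_modular_def by (rule nn_integral_cong_AE)
    then show False using J by simp
  qed
  show ?thesis
  proof (rule ccontr)
    \<comment> \<open>\<open>ennreal\<close> truncates a negative \<open>?c\<close> to 0, so the
      inequality \<open>le\<close> is read back over the reals only once
      \<open>0 \<le> l < ?c\<close> is known.\<close>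
    assume neg: "\<not> ?thesis"
    have "integral\<^sup>L mu_frac a \<ge> 0" using a0 by simp
    then have "l \<ge> 0" using eq pos by (simp add: zero_le_mult_iff)
    then have "?c * integral\<^sup>L (lebesgue_on \<Omega>) b \<le> l * integral\<^sup>L (lebesgue_on \<Omega>) b"
      using le pos neg by (simp add: ennreal_mult[symmetric])
    then show False using pos neg by simp
  qed
qed

theorem proposition1p5:
  fixes \<Omega> :: "(real ^ 'n) set"
    and s \<alpha>\<^sub>0 \<epsilon> :: real
    and G g :: "real \<Rightarrow> real"
    and u :: "real \<Rightarrow> real ^ 'n \<Rightarrow> real"
    and lam :: "real \<Rightarrow> real"
  assumes "open \<Omega>" and "connected \<Omega>" and "\<Omega> \<noteq> {}" and "bounded \<Omega>" and "lipschitz_boundary \<Omega>"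
    and "0 < s" and "s < 1"
    and "young_function G g"
    and "(\<integral>\<^sup>+t\<in>{1..}. ennreal ((t / G t) powr (s / (real CARD('n) - s))) \<partial>lborel) = \<infinity>"
    and "(\<integral>\<^sup>+t\<in>{0<..1}. ennreal ((t / G t) powr (s / (real CARD('n) - s))) \<partial>lborel) < \<infinity>"
    and "\<alpha>\<^sub>0 > 0"
    and "\<And>\<alpha>. \<alpha> > 0 \<Longrightarrow> minimizer s G \<Omega> \<alpha> (u \<alpha>)"
    and "\<And>\<alpha>. \<alpha> > 0 \<Longrightarrow> lam \<alpha> > 0"
    and "\<And>\<alpha>. \<alpha> > 0 \<Longrightarrow> weak_solution s G g \<Omega> (lam \<alpha>) (u \<alpha>)"
    and "\<epsilon> > 0"
    and "diameter \<Omega> \<le>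
           (1 / (2 * (1 + \<epsilon>)) *
             min 1 (real CARD('n) * measure lebesgue (ball (0 :: real ^ 'n) 1) / (2 * s))) powr (1 / s)"
  shows "(\<forall>\<alpha>>0. lam \<alpha> \<ge> \<epsilon>) \<and> (INF \<alpha>\<in>{0<..\<alpha>\<^sub>0}. lam \<alpha>) \<ge> \<epsilon>"
proof -
  let ?n = "real CARD('n)" and ?d = "diameter \<Omega>"
  have vol: "measure lebesgue (ball (0 :: real ^ 'n) 1) = unit_ball_vol ?n"
    using content_ball[of 1 "0 :: real ^ 'n"] by simp
  have diam: "dist x y \<le> ?d" if "x \<in> \<Omega>" "y \<in> \<Omega>" for x y
    using diameter_bounded_bound[OF \<open>bounded \<Omega>\<close>] that .
  \<comment> \<open>A nonempty open set contains a ball, hence two distinct points.\<close>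
  have d: "0 < ?d"
  proof -
    obtain p e where e: "e > 0" "ball p e \<subseteq> \<Omega>"
      using \<open>open \<Omega>\<close> \<open>\<Omega> \<noteq> {}\<close> by (metis open_contains_ball ex_in_conv)
    obtain v :: "real ^ 'n" where v: "norm v = 1"
      using vector_choose_size[of 1] by auto
    have "dist p (p + (e / 2) *\<^sub>R v) \<le> ?d"
      using e v by (intro diam) (auto simp: dist_norm subset_iff)
    moreover have "dist p (p + (e / 2) *\<^sub>R v) > 0"
      using e v by (auto simp: dist_norm)
    ultimately show ?thesis by linarith
  qed
  have n: "?n \<ge> 1" by (simp add: Suc_leI)
  \<comment> \<open>The premise left open is positivity of the volume of the unit ball.\<close>
  note c = diameter_condition_imp[OF d assms(6,7) \<open>\<epsilon> > 0\<close> _ n assms(16)[unfolded vol]]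
  have "\<epsilon> \<le> lam \<alpha>" if \<alpha>: "\<alpha> > 0" for \<alpha>
  proof -
    \<comment> \<open>The constraint of the minimization fixes this value to
      \<open>\<alpha> > 0\<close>.\<close>
    have "energy_J G \<Omega> (u \<alpha>) \<noteq> 0"
      using assms(12)[OF \<alpha>] \<alpha> by (simp add: minimizer_def is_arg_min_def)
    with weak_solution_eigenvalue_ge[OF assms(8,1,3) diam d c(1) assms(6) assms(14)[OF \<alpha>]]
    show ?thesis using c(2) by simp
  qed
  moreover have "\<epsilon> \<le> (INF \<alpha>\<in>{0<..\<alpha>\<^sub>0}. lam \<alpha>)"
    using \<open>\<alpha>\<^sub>0 > 0\<close> calculation by (intro cINF_greatest) auto
  ultimately show ?thesis by blast
qed

end
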